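(* Let $P=(V,\le)$ be a poset, $G$ its incomparability graph, $X\subseteq V$ and $r\in\mathbb N$. (a) If $X$ is an initial segment (respectively a final segment, respectively an order convex subset) of $P$, then $B_G(X,r)$ is an initial segment (respectively a final segment, respectively an order convex subset) of $P$. In particular, for all $x\in V$ and $r\in\mathbb N$, $B_G(x,r)$ is order convex. (b) If $X$ is order convex, then the graph induced by $G$ on $B_G(X,r)$ is an isometric subgraph of $G$. In particular, if $X$ is included in a connected component of $G$, then the graph induced by $G$ on $B_G(X,r)$ is connected.
   Context: $\mathbb N$ is the set of nonnegative integers. The incomparability graph $G$ of $P=(V,\le)$ has vertex set $V$ and edges the pairs of incomparable elements. $d_G(x,y)$ is the length of a shortest path from $x$ to $y$ in $G$ ($\infty$ if none). $B_G(x,r):=\{y\in V: d_G(x,y)\le r\}$ and $B_G(X,r):=\{v\in V: d_G(v,x)\le r\text{ for some }x\in X\}$. A subset $I\subseteq V$ is an initial segment if $x\in V$, $y\in I$ and $x\le y$ imply $x\in I$; final segments are defined dually. $X\subseteq V$ is order convex if $x\le z\le y$ with $x,y\in X$ implies $z\in X$. The graph $G'$ induced by $G$ on $A\subseteq V$ is an isometric subgraph of $G$ if $d_{G'}(x,y)=d_G(x,y)$ for all $x,y\in A$.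
   Formalization: Part (b) is stated for r ≥ 1 only: for r = 0 it fails, e.g. V = {0,1,2} with 0 < 1 and 2 incomparable to both, X = {0,1}, where d_G(0,1) = 2 but the graph induced on X has no edges. *)

theory Defs
  imports "Graph_Theory.Digraph_Component" "HOL-Library.Extended_Nat"
begin

text \<open>
  A poset is a carrier \<open>V\<close> with a relation \<open>P\<close> such that \<^term>\<open>partial_order_on V P\<close>;
  \<open>(x, y) \<in> P\<close> stands for \<open>x \<le> y\<close>.
\<close>

definition initial_segment :: "'a set \<Rightarrow> 'a rel \<Rightarrow> 'a set \<Rightarrow> bool" where
  "initial_segment V P I \<longleftrightarrow>
     I \<subseteq> V \<and> (\<forall>x\<in>V. \<forall>y\<in>I. (x, y) \<in> P \<longrightarrow> x \<in> I)"

definition final_segment :: "'a set \<Rightarrow> 'a rel \<Rightarrow> 'a set \<Rightarrow> bool" where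
  "final_segment V P F \<longleftrightarrow>
     F \<subseteq> V \<and> (\<forall>x\<in>V. \<forall>y\<in>F. (y, x) \<in> P \<longrightarrow> x \<in> F)"

definition order_convex :: "'a set \<Rightarrow> 'a rel \<Rightarrow> 'a set \<Rightarrow> bool" where
  "order_convex V P X \<longleftrightarrow>
     X \<subseteq> V \<and> (\<forall>x\<in>X. \<forall>y\<in>X. \<forall>z\<in>V. (x, z) \<in> P \<and> (z, y) \<in> P \<longrightarrow> z \<in> X)"

text \<open>
  An undirected graph is a symmetric digraph: the edge \<open>{x, y}\<close> is the pair of arcs
  \<open>(x, y)\<close>, \<open>(y, x)\<close>. Vertex sets may be infinite.
\<close>

definition incomparability_graph :: "'a set \<Rightarrow> 'a rel \<Rightarrow> ('a, 'a \<times> 'a) pre_digraph" where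
  "incomparability_graph V P =
     \<lparr> verts = V,
       arcs = {(x, y). x \<in> V \<and> y \<in> V \<and> (x, y) \<notin> P \<and> (y, x) \<notin> P},
       tail = fst, head = snd \<rparr>"

text \<open>If no path exists the infimum is over the empty set, i.e. \<open>\<infinity>\<close>.\<close>

definition graph_dist :: "('a, 'b) pre_digraph \<Rightarrow> 'a \<Rightarrow> 'a \<Rightarrow> enat" where
  "graph_dist G x y = (INF p \<in> {p. pre_digraph.apath G x p y}. enat (length p))"

definition graph_ball :: "('a, 'b) pre_digraph \<Rightarrow> 'a \<Rightarrow> nat \<Rightarrow> 'a set" where
  "graph_ball G x r = {y \<in> verts G. graph_dist G x y \<le> enat r}"

definition graph_set_ball :: "('a, 'b) pre_digraph \<Rightarrow> 'a set \<Rightarrow> nat \<Rightarrow> 'a set" where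
  "graph_set_ball G X r = {v \<in> verts G. \<exists>x\<in>X. graph_dist G v x \<le> enat r}"

definition isometric_subgraph :: "('a, 'b) pre_digraph \<Rightarrow> ('a, 'b) pre_digraph \<Rightarrow> bool" where
  "isometric_subgraph H G \<longleftrightarrow>
     induced_subgraph H G \<and>
     (\<forall>x\<in>verts H. \<forall>y\<in>verts H. graph_dist H x y = graph_dist G x y)"

text \<open>
  The library's \<^const>\<open>connected\<close> excludes the graph without vertices. Here that graph
  counts as connected, so the empty vertex set needs no exclusion.
\<close>

definition connected_or_null :: "('a, 'b) pre_digraph \<Rightarrow> bool" where
  "connected_or_null G \<longleftrightarrow> verts G = {} \<or> connected G"

text \<open>
  In a symmetric digraph the strongly connected components are the connected components
  of the underlying undirected graph.
\<close>

definition in_connected_component :: "('a, 'b) pre_digraph \<Rightarrow> 'a set \<Rightarrow> bool" where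
  "in_connected_component G X \<longleftrightarrow> (\<exists>C \<in> pre_digraph.sccs G. X \<subseteq> verts C)"

end

theory Submission
  imports Defs
begin

text \<open>
  Balls grow one step at a time, so (a) is an induction on \<open>r\<close>: if \<open>z \<le> y\<close>, \<open>y\<close> is adjacent to \<open>w\<close>
  and \<open>z\<close> is not, then \<open>z \<le> w\<close>, since \<open>w \<le> z\<close> would give \<open>w \<le> y\<close>.

  For (b) it suffices to find, for \<open>x, y\<close> in the ball \<open>B\<close> at distance \<open>n + 1\<close>, a neighbour of \<open>x\<close>
  in \<open>B\<close> at distance at most \<open>n\<close> from \<open>y\<close>. Say \<open>x < y\<close> and let \<open>x, x1, x2, \<dots>, y\<close> be a
  geodesic with \<open>x1\<close> outside \<open>B\<close>. All vertices after \<open>x1\<close> are above \<open>x\<close>, because a walk that avoids the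
  neighbours of \<open>x\<close> cannot pass from below \<open>x\<close> to above it. As \<open>x1\<close> is outside \<open>B\<close>, the vertex \<open>x\<close> has a
  neighbour \<open>w\<close> in the ball of radius \<open>r - 1\<close>, and \<open>w\<close> is comparable with \<open>x1\<close>. If \<open>x1 < w\<close>, then \<open>w\<close> is
  adjacent to \<open>x2\<close> and can replace \<open>x1\<close>. If \<open>w < x1\<close>, convexity forbids \<open>x1 < y\<close>, so \<open>x1\<close> is
  adjacent to \<open>y\<close>, and the neighbour of \<open>y\<close> in the smaller ball is adjacent to \<open>x\<close>.
\<close>

section \<open>Distances in digraphs\<close>

text \<open>Distances are handled only through their finite upper bounds; an infinite one is a
  distance without any such bound and needs no separate case.\<close>

lemma enat_eqI_le_enat:
  fixes a b :: enat
  assumes "\<And>n. a \<le> enat n \<longleftrightarrow> b \<le> enat n"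
  shows "a = b"
  using assms by (metis dual_order.antisym enat_ord_simps(3) less_eq_enat_def not_enat_eq order_refl)

context wf_digraph
begin

text \<open>Each step of \<open>awalk_to_apath\<close> cuts out a closed middle piece. Hence walks
  may replace paths in bounds on the distance, and distinctness of vertices need not be
  tracked.\<close>

lemma length_awalk_to_apath:
  assumes "awalk u p v"
  shows "length (awalk_to_apath p) \<le> length p"
  using assms
proof (induct rule: awalk_to_apath_induct)
  case (path p)
  then show ?case by (auto simp: awalk_to_apath.simps)
next
  case (decomp p q r s)
  have "p = q @ r @ s" by (rule awalk_cyc_decompE[OF decomp(2,1,3)])
  then have "length (q @ s) \<le> length p" by simp
  with decomp(4) show ?case by (simp only: step_awalk_to_apath[OF decomp(1-3)])
qed

lemma graph_dist_le_iff_awalk: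
  "graph_dist G x y \<le> enat n \<longleftrightarrow> (\<exists>p. awalk x p y \<and> length p \<le> n)"
proof
  assume le: "graph_dist G x y \<le> enat n"
  show "\<exists>p. awalk x p y \<and> length p \<le> n"
  proof (rule ccontr)
    assume none: "\<not> ?thesis"
    \<comment> \<open>This also covers an unreachable \<open>y\<close>, where the infimum is over
      the empty set.\<close>
    have "enat (Suc n) \<le> graph_dist G x y"
      unfolding graph_dist_def
      by (rule INF_greatest) (use none in \<open>auto simp: not_less_eq_eq dest: awalkI_apath\<close>)
    from order_trans[OF this le] show False by simp
  qed
next
  assume "\<exists>p. awalk x p y \<and> length p \<le> n"
  then obtain p where p: "awalk x p y" "length p \<le> n" by blast
  have "graph_dist G x y \<le> enat (length (awalk_to_apath p))"
    unfolding graph_dist_def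
    by (rule INF_lower) (use p apath_awalk_to_apath in auto)
  also have "\<dots> \<le> enat n"
    using length_awalk_to_apath[OF p(1)] p(2) by simp
  finally show "graph_dist G x y \<le> enat n" .
qed

lemma graph_dist_le_0_iff: "graph_dist G x y \<le> enat 0 \<longleftrightarrow> x = y \<and> x \<in> verts G"
  by (auto simp: graph_dist_le_iff_awalk awalk_Nil_iff)

text \<open>Splitting off the first arc of a walk gives the recursion behind the later inductions on
  distance. The disjunct \<open>x = y\<close> accounts for the empty walk.\<close>

lemma graph_dist_le_Suc_iff:
  "graph_dist G x y \<le> enat (Suc n) \<longleftrightarrow>
     x = y \<and> x \<in> verts G \<or> (\<exists>z. x \<rightarrow>\<^bsub>G\<^esub> z \<and> graph_dist G z y \<le> enat n)"
    (is "?L \<longleftrightarrow> ?R")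
proof
  assume ?L
  then obtain p where p: "awalk x p y" "length p \<le> Suc n"
    by (auto simp: graph_dist_le_iff_awalk)
  show ?R
  proof (cases p)
    case Nil
    with p show ?thesis by (auto simp: awalk_Nil_iff)
  next
    case (Cons e q)
    with p have "x \<rightarrow>\<^bsub>G\<^esub> head G e" "awalk (head G e) q y" "length q \<le> n"
      by (auto simp: awalk_Cons_iff intro: in_arcs_imp_in_arcs_ends)
    then show ?thesis by (auto simp: graph_dist_le_iff_awalk)
  qed
next
  assume ?R
  then show ?L
  proof
    assume "x = y \<and> x \<in> verts G"
    then have "awalk x [] y" by (auto simp: awalk_Nil_iff)
    then show ?L by (fastforce simp: graph_dist_le_iff_awalk)
  next
    assume "\<exists>z. x \<rightarrow>\<^bsub>G\<^esub> z \<and> graph_dist G z y \<le> enat n"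
    then obtain e p where "e \<in> arcs G" "tail G e = x" "awalk (head G e) p y" "length p \<le> n"
      by (auto simp: graph_dist_le_iff_awalk elim!: arcE)
    then have "awalk x (e # p) y" "length (e # p) \<le> Suc n"
      by (auto simp: awalk_Cons_iff)
    then show ?L unfolding graph_dist_le_iff_awalk by blast
  qed
qed

lemma reachable_iff_graph_dist: "x \<rightarrow>\<^sup>* y \<longleftrightarrow> (\<exists>n. graph_dist G x y \<le> enat n)"
  by (auto simp: reachable_awalk graph_dist_le_iff_awalk)

lemma strongly_connected_imp_connected:
  assumes "strongly_connected G"
  shows "connected G"
  using assms by (auto simp: connected_def strongly_connected_def intro: reachable_mk_symmetricI)

end

lemma graph_dist_subgraph_le:
  assumes "subgraph H G" "graph_dist H x y \<le> enat n"
  shows "graph_dist G x y \<le> enat n"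
proof -
  interpret G: wf_digraph G using assms(1) by (auto simp: subgraph_def)
  interpret H: wf_digraph H using assms(1) by (auto simp: subgraph_def)
  from assms show ?thesis
    by (auto simp: G.graph_dist_le_iff_awalk H.graph_dist_le_iff_awalk
        intro: G.subgraph_awalk_imp_awalk)
qed

section \<open>Incomparability graphs\<close>

locale poset =
  fixes V :: "'a set" and P :: "'a rel"
  assumes po: "partial_order_on V P"
begin

abbreviation "G \<equiv> incomparability_graph V P"

definition incomp :: "'a \<Rightarrow> 'a \<Rightarrow> bool"  (infix \<open>\<parallel>\<close> 50) where
  "x \<parallel> y \<longleftrightarrow> x \<in> V \<and> y \<in> V \<and> (x, y) \<notin> P \<and> (y, x) \<notin> P"

lemma le_trans: "(x, y) \<in> P \<Longrightarrow> (y, z) \<in> P \<Longrightarrow> (x, z) \<in> P"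
  using po by (auto simp: partial_order_on_def preorder_on_def dest: transD)

lemma incomp_sym: "x \<parallel> y \<Longrightarrow> y \<parallel> x"
  by (auto simp: incomp_def)

lemma incompD: "x \<parallel> y \<Longrightarrow> x \<in> V" "x \<parallel> y \<Longrightarrow> y \<in> V"
  "x \<parallel> y \<Longrightarrow> (x, y) \<notin> P" "x \<parallel> y \<Longrightarrow> (y, x) \<notin> P"
  by (auto simp: incomp_def)

lemma comparable_cases:
  assumes "x \<in> V" "y \<in> V"
  obtains "x \<parallel> y" | "(x, y) \<in> P" | "(y, x) \<in> P"
  using assms by (auto simp: incomp_def)

lemma verts_G [simp]: "verts G = V"
  by (simp add: incomparability_graph_def)

lemma arcs_ends_G: "(x, y) \<in> arcs_ends G \<longleftrightarrow> x \<parallel> y"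
  by (force simp: incomparability_graph_def incomp_def arcs_ends_def arc_to_ends_def)

lemma wf_G: "wf_digraph G"
  by unfold_locales (auto simp: incomparability_graph_def)

sublocale G: wf_digraph G by (rule wf_G)

section \<open>Distances and balls in the incomparability graph\<close>

lemma dist_le_0_iff: "graph_dist G x y \<le> enat 0 \<longleftrightarrow> x = y \<and> x \<in> V"
  using G.graph_dist_le_0_iff by simp

lemma dist_le_Suc_iff:
  "graph_dist G x y \<le> enat (Suc n) \<longleftrightarrow>
     x = y \<and> x \<in> V \<or> (\<exists>z. x \<parallel> z \<and> graph_dist G z y \<le> enat n)"
  using G.graph_dist_le_Suc_iff by (simp add: arcs_ends_G)

lemma dist_mono: "graph_dist G x y \<le> enat m \<Longrightarrow> m \<le> n \<Longrightarrow> graph_dist G x y \<le> enat n"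
  by (meson enat_ord_simps(1) order_trans)

text \<open>The recursion extends a walk at its start; symmetry of the distance needs the extension
  at its end.\<close>

lemma dist_snoc: "graph_dist G x y \<le> enat n \<Longrightarrow> y \<parallel> z \<Longrightarrow> graph_dist G x z \<le> enat (Suc n)"
proof (induction n arbitrary: x)
  case 0
  then show ?case by (auto simp: dist_le_0_iff dist_le_Suc_iff[of _ _ 0] dest: incompD)
next
  case (Suc n)
  have "graph_dist G z z \<le> enat (Suc n)"
    using incompD(2)[OF Suc.prems(2)] by (simp add: dist_le_Suc_iff)
  with Suc show ?case by (auto simp: dist_le_Suc_iff[of x _ "Suc n"] dist_le_Suc_iff[of x y n])
qed

lemma dist_sym_le: "graph_dist G x y \<le> enat n \<Longrightarrow> graph_dist G y x \<le> enat n"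
  by (induction n arbitrary: x)
    (auto simp: dist_le_0_iff dist_le_Suc_iff[of x y for x] dist_le_Suc_iff[of x x for x]
      intro: dist_snoc dest: incomp_sym)

lemma dist_sym: "graph_dist G x y = graph_dist G y x"
  by (rule enat_eqI_le_enat) (blast intro: dist_sym_le)

lemma graph_ball_eq: "graph_ball G x r = graph_set_ball G {x} r"
  by (auto simp: graph_ball_def graph_set_ball_def dist_sym[of x])

lemma ball_subset: "graph_set_ball G X r \<subseteq> V"
  by (auto simp: graph_set_ball_def)

lemma ball_0: "X \<subseteq> V \<Longrightarrow> graph_set_ball G X 0 = X"
  by (auto simp: graph_set_ball_def dist_le_0_iff)

lemma ball_mono: "m \<le> n \<Longrightarrow> graph_set_ball G X m \<subseteq> graph_set_ball G X n"
  by (auto simp: graph_set_ball_def intro: dist_mono)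

lemma subset_ball: "X \<subseteq> V \<Longrightarrow> X \<subseteq> graph_set_ball G X r"
  using ball_mono[of 0 r X] by (simp add: ball_0)

lemma ball_SucI: "w \<in> graph_set_ball G X r \<Longrightarrow> v \<parallel> w \<Longrightarrow> v \<in> graph_set_ball G X (Suc r)"
  by (auto simp: graph_set_ball_def dist_le_Suc_iff dest: incompD)

lemma ball_SucE:
  assumes "v \<in> graph_set_ball G X (Suc r)"
  obtains "v \<in> X" | w where "v \<parallel> w" "w \<in> graph_set_ball G X r"
  using assms by (auto simp: graph_set_ball_def dist_le_Suc_iff dest: incompD)

section \<open>Segments and convexity are inherited by balls\<close>

lemma initial_segment_ball:
  assumes "initial_segment V P X"
  shows "initial_segment V P (graph_set_ball G X r)"
proof (induction r)
  case 0
  with assms show ?case by (simp add: ball_0 initial_segment_def)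
next
  case (Suc r)
  have XV: "X \<subseteq> V" using assms by (simp add: initial_segment_def)
  have "x \<in> graph_set_ball G X (Suc r)"
    if xy: "x \<in> V" "y \<in> graph_set_ball G X (Suc r)" "(x, y) \<in> P" for x y
    using xy(2)
  proof (cases rule: ball_SucE)
    case 1
    with assms xy have "x \<in> X" by (auto simp: initial_segment_def)
    with subset_ball[OF XV] show ?thesis by blast
  next
    case (2 w)
    from xy(1) incompD(2)[OF 2(1)] show ?thesis
    proof (cases rule: comparable_cases)
      case 1
      with 2 show ?thesis by (blast intro: ball_SucI)
    next
      case 2
      with Suc \<open>w \<in> graph_set_ball G X r\<close> xy have "x \<in> graph_set_ball G X r" by (auto simp: initial_segment_def)
      then show ?thesis using ball_mono[of r "Suc r" X] by auto
    next
      case 3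
      with xy \<open>y \<parallel> w\<close> show ?thesis by (auto dest: le_trans incompD)
    qed
  qed
  then show ?case using ball_subset by (auto simp: initial_segment_def)
qed

text \<open>Reversing the order leaves the incomparability graph unchanged, so each one-sided
  statement below yields its mirror image.\<close>

lemma dual: "poset V (P\<inverse>)"
  using po by (simp add: poset_def)

lemma dual_graph: "incomparability_graph V (P\<inverse>) = G"
  by (auto simp: incomparability_graph_def)

lemma final_segment_iff_dual: "final_segment V P X \<longleftrightarrow> initial_segment V (P\<inverse>) X"
  by (auto simp: final_segment_def initial_segment_def)

lemma order_convex_dual: "order_convex V (P\<inverse>) X \<longleftrightarrow> order_convex V P X"
  by (auto simp: order_convex_def)

lemma final_segment_ball:
  "final_segment V P X \<Longrightarrow> final_segment V P (graph_set_ball G X r)"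
  using poset.initial_segment_ball[OF dual, of X r]
  by (simp add: final_segment_iff_dual dual_graph)

text \<open>One side of the convexity step. If \<open>x\<close> is in \<open>X\<close>, it serves as
  \<open>w\<close>. Otherwise take a neighbour \<open>w\<close> of \<open>x\<close> in the smaller
  ball: \<open>z \<le> w\<close> would give \<open>x \<le> w\<close>, so \<open>z\<close> is
  adjacent to \<open>w\<close> or above it.\<close>

lemma ball_or_above:
  assumes "X \<subseteq> V" "x \<in> graph_set_ball G X (Suc r)" "(x, z) \<in> P" "z \<in> V"
  shows "z \<in> graph_set_ball G X (Suc r) \<or> (\<exists>w\<in>graph_set_ball G X r. (w, z) \<in> P)"
  using assms(2)
proof (cases rule: ball_SucE)
  case 1
  with assms show ?thesis using subset_ball by blast
next
  case (2 w)
  from incompD(2)[OF 2(1)] assms(4) show ?thesis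
    by (cases rule: comparable_cases)
      (use 2 assms in \<open>auto intro: ball_SucI dest: le_trans incomp_sym incompD\<close>)
qed

lemma order_convex_ball:
  assumes "order_convex V P X"
  shows "order_convex V P (graph_set_ball G X r)"
proof -
  have XV: "X \<subseteq> V" using assms by (simp add: order_convex_def)
  show ?thesis
  proof (induction r)
    case 0
    from assms show ?case by (simp add: ball_0[OF XV])
  next
    case (Suc r)
    have "z \<in> graph_set_ball G X (Suc r)"
      if xyz: "x \<in> graph_set_ball G X (Suc r)" "y \<in> graph_set_ball G X (Suc r)"
        "z \<in> V" "(x, z) \<in> P" "(z, y) \<in> P" for x y z
    proof (rule ccontr)
      assume z: "z \<notin> graph_set_ball G X (Suc r)"
      obtain a where "a \<in> graph_set_ball G X r" "(a, z) \<in> P"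
        using ball_or_above[OF XV, of x r z] xyz z by blast
      moreover obtain b where "b \<in> graph_set_ball G X r" "(z, b) \<in> P"
        using poset.ball_or_above[OF dual XV, of y r z] xyz z by (auto simp: dual_graph)
      \<comment> \<open>Now \<open>z\<close> is squeezed between two points of the smaller ball,
        which is convex by induction.\<close>
      ultimately have "z \<in> graph_set_ball G X r"
        using Suc \<open>z \<in> V\<close> unfolding order_convex_def by blast
      with z show False using ball_mono[of r "Suc r" X] by auto
    qed
    then show ?case using ball_subset[of X "Suc r"] unfolding order_convex_def by blast
  qed
qed

lemma order_convex_singleton: "x \<in> V \<Longrightarrow> order_convex V P {x}"
  using po by (auto simp: order_convex_def partial_order_on_def dest: antisymD)

section \<open>Geodesic steps that stay inside the ball\<close>

text \<open>Induction backwards from \<open>y\<close>: if the next vertex \<open>z'\<close> is above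
  \<open>x\<close>, then \<open>z \<le> x\<close> would make \<open>z\<close> and \<open>z'\<close>
  comparable, and \<open>x\<close> adjacent to \<open>z\<close> would make \<open>x\<close> too
  close to \<open>y\<close>.\<close>

lemma geodesic_above:
  assumes "(x, y) \<in> P" "x \<in> V"
  shows "graph_dist G z y \<le> enat m \<Longrightarrow> \<not> graph_dist G x y \<le> enat (Suc m) \<Longrightarrow> (x, z) \<in> P"
proof (induction m arbitrary: z)
  case 0
  with assms show ?case by (simp add: dist_le_0_iff)
next
  case (Suc m)
  from Suc.prems(1) consider "z = y" | z' where "z \<parallel> z'" "graph_dist G z' y \<le> enat m"
    by (auto simp: dist_le_Suc_iff)
  then show ?case
  proof cases
    case 1
    with assms show ?thesis by simp
  next
    case (2 z')
    have xz': "(x, z') \<in> P"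
      using Suc.IH[OF 2(2)] Suc.prems(2) dist_mono[of x y "Suc m" "Suc (Suc m)"] by auto
    from assms(2) incompD(1)[OF 2(1)] show ?thesis
    proof (cases rule: comparable_cases)
      case 1
      with Suc.prems show ?thesis by (subst (asm) (2) dist_le_Suc_iff) auto
    next
      case 3
      with xz' 2 show ?thesis by (auto dest: le_trans incompD)
    qed
  qed
qed

lemma geodesic_step_in_ball_aux:
  assumes conv: "order_convex V P X"
    and x: "x \<in> graph_set_ball G X (Suc s)" and y: "y \<in> graph_set_ball G X (Suc s)"
    and xy: "(x, y) \<in> P"
    and d: "graph_dist G x y \<le> enat (Suc (Suc m))" and nd: "\<not> graph_dist G x y \<le> enat (Suc m)"
  shows "\<exists>w\<in>graph_set_ball G X (Suc s). x \<parallel> w \<and> graph_dist G w y \<le> enat (Suc m)"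
proof -
  let ?A = "graph_set_ball G X s" and ?B = "graph_set_ball G X (Suc s)"
  have XV: "X \<subseteq> V" using conv by (simp add: order_convex_def)
  have AB: "?A \<subseteq> ?B" by (rule ball_mono) simp
  have XA: "X \<subseteq> ?A" by (rule subset_ball[OF XV])
  have convB: "b \<in> ?B" if "a \<in> ?B" "c \<in> ?B" "b \<in> V" "(a, b) \<in> P" "(b, c) \<in> P" for a b c
    using order_convex_ball[OF conv, of "Suc s"] that unfolding order_convex_def by blast
  have xV: "x \<in> V" and yV: "y \<in> V" using x y ball_subset by blast+
  have xny: "x \<noteq> y" using nd xV by (auto simp: dist_le_Suc_iff)
  have xiy: "\<not> x \<parallel> y"
    using nd yV dist_mono[of y y 0 m] by (auto simp: dist_le_Suc_iff dist_le_0_iff)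
  obtain x1 where x1: "x \<parallel> x1" "graph_dist G x1 y \<le> enat (Suc m)"
    using d xny by (subst (asm) dist_le_Suc_iff) auto
  show ?thesis
  proof (cases "x1 \<in> ?B")
    case True
    with x1 show ?thesis by blast
  next
    case x1B: False
    have x1V: "x1 \<in> V" using x1 incompD by blast
    have no_nbr: "\<not> x1 \<parallel> a" if "a \<in> ?A" for a
      using x1B that by (blast intro: ball_SucI)
    obtain x2 where x2: "x1 \<parallel> x2" "graph_dist G x2 y \<le> enat m"
      using x1 xiy by (auto simp: dist_le_Suc_iff)
    have xx2: "(x, x2) \<in> P" by (rule geodesic_above[OF xy xV x2(2) nd])
    \<comment> \<open>A neighbour of a point of \<open>X\<close> lies in the ball because its radius
      is positive, whereas \<open>x1\<close> does not.\<close>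
    have "x \<notin> X" using no_nbr XA x1(1) incomp_sym by blast
    with x obtain w where w: "x \<parallel> w" "w \<in> ?A" by (auto elim: ball_SucE)
    have wV: "w \<in> V" and x2V: "x2 \<in> V" using w x2 incompD by blast+
    from x1V wV show ?thesis
    proof (cases rule: comparable_cases)
      case 1
      with no_nbr w show ?thesis by blast
    next
      case 2
      \<comment> \<open>Here \<open>w \<le> x2\<close> would give \<open>x1 \<le> x2\<close>, and
        \<open>x2 \<le> w\<close> would give \<open>x \<le> w\<close>.\<close>
      have "w \<parallel> x2"
        using wV x2V
      proof (cases rule: comparable_cases)
        case 2
        with \<open>(x1, w) \<in> P\<close> x2(1) show ?thesis by (auto dest: le_trans incompD)
      next
        case 3
        with xx2 w(1) show ?thesis by (auto dest: le_trans incompD)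
      qed
      with x2 have "graph_dist G w y \<le> enat (Suc m)" by (auto simp: dist_le_Suc_iff)
      with w AB show ?thesis by blast
    next
      case wx1: 3
      have x1y: "x1 \<parallel> y"
        using x1V yV
      proof (cases rule: comparable_cases)
        case 2
        with convB[of w y x1] wx1 w y AB x1V x1B show ?thesis by blast
      next
        case 3
        with xy x1 show ?thesis by (auto dest: le_trans incompD)
      qed
      have "y \<notin> X" using no_nbr XA x1y by blast
      with y obtain v where v: "y \<parallel> v" "v \<in> ?A" by (auto elim: ball_SucE)
      have vV: "v \<in> V" using v incompD by blast
      \<comment> \<open>Were \<open>x1 \<le> v\<close>, then \<open>x1\<close> would lie between
        \<open>w\<close> and \<open>v\<close>, hence in the convex ball.\<close>
      have vx1: "(v, x1) \<in> P"
        using x1V vV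
      proof (cases rule: comparable_cases)
        case 1
        with no_nbr v show ?thesis by blast
      next
        case 2
        with convB[of w v x1] wx1 w v AB x1V x1B show ?thesis by blast
      qed
      \<comment> \<open>Here \<open>x \<le> v\<close> would give \<open>x \<le> x1\<close>, and
        \<open>v \<le> x\<close> would give \<open>v \<le> y\<close>. So \<open>v\<close> is a
        common neighbour of \<open>x\<close> and \<open>y\<close>.\<close>
      have "x \<parallel> v"
        using xV vV
      proof (cases rule: comparable_cases)
        case 2
        with vx1 x1 show ?thesis by (auto dest: le_trans incompD)
      next
        case 3
        with xy v show ?thesis by (auto dest: le_trans incompD)
      qed
      moreover have "graph_dist G v y \<le> enat (Suc m)"
        using v(1) yV dist_mono[of y y 0 m]
        by (auto simp: dist_le_Suc_iff[of v] dist_le_0_iff dest: incomp_sym)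
      ultimately show ?thesis using v AB by blast
    qed
  qed
qed

lemma incomp_dual: "poset.incomp V (P\<inverse>) x y \<longleftrightarrow> x \<parallel> y"
  using poset.incomp_def[OF dual, of x y] by (auto simp: incomp_def)

lemma geodesic_step_in_ball:
  assumes conv: "order_convex V P X"
    and x: "x \<in> graph_set_ball G X (Suc s)" and y: "y \<in> graph_set_ball G X (Suc s)"
    and d: "graph_dist G x y \<le> enat (Suc n)" and nd: "\<not> graph_dist G x y \<le> enat n"
  shows "\<exists>w\<in>graph_set_ball G X (Suc s). x \<parallel> w \<and> graph_dist G w y \<le> enat n"
proof (cases "x \<parallel> y")
  case True
  with y show ?thesis
    using dist_mono[of y y 0 n] by (auto simp: dist_le_0_iff dest: incompD)
next
  case False
  have V: "x \<in> V" "y \<in> V" using x y ball_subset by blast+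
  then have "x \<noteq> y" using nd dist_mono[of y y 0 n] by (auto simp: dist_le_0_iff)
  \<comment> \<open>Distinct nonadjacent points have distance at least 2, as the auxiliary lemma
    presupposes; the order dual reduces \<open>y \<le> x\<close> to
    \<open>x \<le> y\<close>.\<close>
  with d False obtain m where n: "n = Suc m"
    by (cases n) (auto simp: dist_le_Suc_iff dist_le_0_iff)
  from V False consider "(x, y) \<in> P" | "(x, y) \<in> P\<inverse>" by (auto simp: incomp_def)
  then show ?thesis
  proof cases
    case 1
    from geodesic_step_in_ball_aux[OF conv x y 1] d nd show ?thesis by (simp add: n)
  next
    case 2
    from poset.geodesic_step_in_ball_aux[OF dual, of X x s y m] 2 conv x y d nd
    show ?thesis by (simp add: n incomp_dual dual_graph order_convex_dual)
  qed
qed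

section \<open>Isometry and connectedness of the induced subgraph\<close>

lemma induced_ball: "A \<subseteq> V \<Longrightarrow> induced_subgraph (G \<restriction> A) G"
  by (auto simp: induced_subgraph_def subgraph_def compatible_def intro: wf_G G.wellformed_induce_subgraph)

lemma arcs_ends_induce: "x \<in> A \<Longrightarrow> y \<in> A \<Longrightarrow> x \<parallel> y \<Longrightarrow> (x, y) \<in> arcs_ends (G \<restriction> A)"
  by (force simp: incomparability_graph_def incomp_def arcs_ends_def arc_to_ends_def)

text \<open>A geodesic is rebuilt inside the ball one vertex at a time. Radius 0 must be excluded:
  the ball is then \<open>X\<close>, and for \<open>X\<close> = {x, y} with x < y and a single
  further element incomparable to both, the distance 2 in \<open>G\<close> becomes infinite.\<close>

lemma isometric_ball:
  assumes conv: "order_convex V P X" and r: "1 \<le> r"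
  shows "isometric_subgraph (G \<restriction> graph_set_ball G X r) G"
proof -
  let ?B = "graph_set_ball G X r"
  let ?H = "G \<restriction> ?B"
  obtain s where s: "r = Suc s" using r by (cases r) auto
  interpret H: wf_digraph ?H ..
  have ind: "induced_subgraph ?H G" by (rule induced_ball[OF ball_subset])
  \<comment> \<open>Only this inequality needs geometry; the converse holds for every
    subgraph.\<close>
  have "graph_dist ?H x y \<le> enat n"
    if "x \<in> ?B" "y \<in> ?B" "graph_dist G x y \<le> enat n" for x y n
    using that
  proof (induction n arbitrary: x)
    case 0
    then show ?case by (simp add: dist_le_0_iff H.graph_dist_le_0_iff)
  next
    case (Suc n)
    show ?case
    proof (cases "graph_dist G x y \<le> enat n")
      case True
      with Suc have "graph_dist ?H x y \<le> enat n" by blast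
      then show ?thesis by (meson enat_ord_simps(1) le_SucI order_refl order_trans)
    next
      case False
      with geodesic_step_in_ball[OF conv, of x s y n] Suc.prems
      obtain w where "w \<in> ?B" "x \<parallel> w" "graph_dist G w y \<le> enat n" by (auto simp: s)
      with Suc show ?thesis
        by (auto simp: H.graph_dist_le_Suc_iff intro: arcs_ends_induce)
    qed
  qed
  then have "graph_dist ?H x y = graph_dist G x y" if "x \<in> ?B" "y \<in> ?B" for x y
    using that graph_dist_subgraph_le[OF induced_imp_subgraph[OF ind]]
    by (intro enat_eqI_le_enat) blast
  with ind show ?thesis by (simp add: isometric_subgraph_def)
qed

text \<open>Any two points of the ball are joined in \<open>G\<close> through points of
  \<open>X\<close>, so their distance is finite, and isometry carries this finiteness to the
  subgraph.\<close>

lemma connected_ball: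
  assumes iso: "isometric_subgraph (G \<restriction> graph_set_ball G X r) G"
    and comp: "in_connected_component G X"
  shows "connected_or_null (G \<restriction> graph_set_ball G X r)"
proof -
  let ?B = "graph_set_ball G X r"
  let ?H = "G \<restriction> ?B"
  interpret H: wf_digraph ?H ..
  obtain C where C: "C \<in> G.sccs" "X \<subseteq> verts C"
    using comp by (auto simp: in_connected_component_def)
  have X: "a \<rightarrow>\<^sup>*\<^bsub>G\<^esub> b" if "a \<in> X" "b \<in> X" for a b
  proof -
    have "a \<rightarrow>\<^sup>*\<^bsub>C\<^esub> b" "subgraph C G"
      using C that by (auto elim!: G.in_sccsE simp: subset_eq)
    then show ?thesis by (rule G.reachable_mono)
  qed
  have "u \<rightarrow>\<^sup>*\<^bsub>?H\<^esub> v" if uv: "u \<in> ?B" "v \<in> ?B" for u v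
  proof -
    obtain a b where "a \<in> X" "b \<in> X" "graph_dist G u a \<le> enat r" "graph_dist G v b \<le> enat r"
      using uv by (auto simp: graph_set_ball_def)
    moreover from this(3) dist_sym_le[OF this(4)]
    have "u \<rightarrow>\<^sup>*\<^bsub>G\<^esub> a" "b \<rightarrow>\<^sup>*\<^bsub>G\<^esub> v"
      unfolding G.reachable_iff_graph_dist by (auto intro: exI[of _ r])
    ultimately have "u \<rightarrow>\<^sup>*\<^bsub>G\<^esub> v" by (meson X G.reachable_trans)
    with iso uv show ?thesis
      by (simp add: G.reachable_iff_graph_dist H.reachable_iff_graph_dist isometric_subgraph_def)
  qed
  then show ?thesis
    unfolding connected_or_null_def
    by (auto intro!: H.strongly_connected_imp_connected)
qed

end

theorem theorem7:
  fixes V :: "'a set" and P :: "'a rel" and G :: "('a, 'a \<times> 'a) pre_digraph"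
    and X :: "'a set" and r :: nat
  assumes "partial_order_on V P"
    and "G = incomparability_graph V P"
    and "X \<subseteq> V"
  shows
    "((initial_segment V P X \<longrightarrow> initial_segment V P (graph_set_ball G X r)) \<and>
      (final_segment V P X \<longrightarrow> final_segment V P (graph_set_ball G X r)) \<and>
      (order_convex V P X \<longrightarrow> order_convex V P (graph_set_ball G X r)) \<and>
      (\<forall>x\<in>V. \<forall>s. order_convex V P (graph_ball G x s))) \<and>
     (order_convex V P X \<and> 1 \<le> r \<longrightarrow>
        isometric_subgraph (G \<restriction> graph_set_ball G X r) G \<and>
        (in_connected_component G X \<longrightarrow>
           connected_or_null (G \<restriction> graph_set_ball G X r)))"
proof -
  interpret poset V P by unfold_locales (rule assms(1))
  show ?thesis
    \<comment> \<open>The ball around a point becomes the ball around a singleton, which is order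
      convex by antisymmetry.\<close>
    unfolding assms(2) graph_ball_eq
    by (blast intro: initial_segment_ball final_segment_ball order_convex_ball
        order_convex_singleton isometric_ball connected_ball)
qed

end
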